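(* Let $X$ be a real Banach space, let $A\subset X$ be nonempty, and let $f:X\to\mathbb{R}$ be a locally Lipschitz continuous function that is Lipschitz continuous of rank $L$ on a neighborhood of $A$. Then: (1) $\partial f(A)$ is nonempty, convex, weak$^*$-compact and bounded by $L$ (i.e. $\|a\|\le L$ for all $a\in\partial f(A)$). (2) $f^0(A;\cdot)$ is finite, positively homogeneous, subadditive, and Lipschitz continuous of rank $L$ on $X$. Moreover it is the support function of $\partial f(A)$, with $$f^0(A;h)=\max_{a\in\partial f(A)}\langle a,h\rangle\quad\text{for all } h\in X.$$ (3) We have $$\partial f(A)=\{a\in X^*\mid \langle a,h\rangle\le f^0(A;h)\ \text{for all } h\in X\}.$$ (4) Let $h\in X$ with $f^0(A;h)<0$, let $x\in A$, and let $t>0$ be such that the open segment $]x,x+th[$ is contained in $A$. Then $$f(x+th)\le f(x)+t\,f^0(A;h)<f(x).$$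
   Context: $X^*$ is the dual of $X$ and $\langle\cdot,\cdot\rangle$ the duality pairing. For $f$ Lipschitz near $x$, Clarke's generalized directional derivative is $f^0(x;h)=\limsup_{y\to x,\,t\downarrow 0}\frac{f(y+th)-f(y)}{t}$ and Clarke's generalized gradient is $\partial f(x)=\{a\in X^*\mid\langle a,h\rangle\le f^0(x;h)\ \forall h\in X\}$. For nonempty $A\subset X$, the gradient of $f$ on $A$ is $\partial f(A):=\overline{\operatorname{conv}}^*\bigcup_{y\in A}\partial f(y)$ (the weak$^*$ closure of the convex hull; it does not denote the mere union), and the directional derivative of $f$ on $A$ in direction $h\in X$ is $f^0(A;h):=\sup_{y\in A}f^0(y;h)$. A function is Lipschitz continuous of rank $L$ on a set $U$ if $|f(u)-f(v)|\le L\|u-v\|$ for all $u,v\in U$. A neighborhood of $A$ is a set containing an open set that contains $A$. *)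

theory Defs
  imports "HOL-Analysis.Analysis"
begin

text \<open>
  The dual of \<open>X\<close> is the type \<open>'a \<Rightarrow>\<^sub>L real\<close>, with the operator norm as dual norm. For
  real-valued operators the strong operator topology is the topology of pointwise
  convergence on \<open>X\<close>, i.e. the weak* topology.
\<close>

abbreviation weak_star_topology :: "('a::real_normed_vector \<Rightarrow>\<^sub>L real) topology"
  where "weak_star_topology \<equiv> strong_operator_topology"

definition locally_lipschitz :: "('a::metric_space \<Rightarrow> 'b::metric_space) \<Rightarrow> bool"
  where "locally_lipschitz f \<longleftrightarrow> (\<forall>x. \<exists>U K. open U \<and> x \<in> U \<and> K-lipschitz_on U f)"

text \<open>
  Directional derivatives take values in the extended reals, so that the upper limit and the
  supremum over a set are the true ones even where they are infinite. The filter \<open>nhds x\<close>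
  (rather than \<open>at x\<close>) allows \<open>y = x\<close> in the limit.
\<close>

definition clarke_dd :: "('a::real_normed_vector \<Rightarrow> real) \<Rightarrow> 'a \<Rightarrow> 'a \<Rightarrow> ereal"
  where "clarke_dd f x h =
    Limsup (nhds x \<times>\<^sub>F at_right 0) (\<lambda>(y, t). ereal ((f (y + t *\<^sub>R h) - f y) / t))"

definition clarke_gradient :: "('a::real_normed_vector \<Rightarrow> real) \<Rightarrow> 'a \<Rightarrow> ('a \<Rightarrow>\<^sub>L real) set"
  where "clarke_gradient f x = {a. \<forall>h. ereal (blinfun_apply a h) \<le> clarke_dd f x h}"

definition clarke_dd_on :: "('a::real_normed_vector \<Rightarrow> real) \<Rightarrow> 'a set \<Rightarrow> 'a \<Rightarrow> ereal"
  where "clarke_dd_on f A h = (SUP y\<in>A. clarke_dd f y h)"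

definition clarke_gradient_on ::
    "('a::real_normed_vector \<Rightarrow> real) \<Rightarrow> 'a set \<Rightarrow> ('a \<Rightarrow>\<^sub>L real) set"
  where "clarke_gradient_on f A =
    weak_star_topology closure_of (convex hull (\<Union>y\<in>A. clarke_gradient f y))"

definition support_function :: "('a::real_normed_vector \<Rightarrow>\<^sub>L real) set \<Rightarrow> 'a \<Rightarrow> ereal"
  where "support_function S h = (SUP a\<in>S. ereal (blinfun_apply a h))"

end

theory Submission
  imports Defs
begin

text \<open>
  Each \<open>f\<^sup>0(y;\<cdot>)\<close> is sublinear and bounded by \<open>L \<parallel>\<cdot>\<parallel>\<close>, so Hahn--Banach provides in every direction a
  subgradient at \<open>y\<close> attaining it; hence \<open>p = f\<^sup>0(A;\<cdot>)\<close> is the support function of the union of the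
  gradients. A separation argument then identifies the weak* closed convex hull with the set of
  all functionals below \<open>p\<close>, which is weak* compact by Tychonoff's theorem. For the descent
  estimate, \<open>f\<^sup>0(y;h) \<le> p(h)\<close> bounds all difference quotients near \<open>y\<close> by \<open>p(h) + \<epsilon>\<close>, and these
  local bounds chain along the segment.
\<close>

subsection \<open>The Hahn--Banach theorem\<close>

definition sublinear :: "('a::real_vector \<Rightarrow> real) \<Rightarrow> bool"
  where "sublinear p \<longleftrightarrow>
    (\<forall>x y. p (x + y) \<le> p x + p y) \<and> (\<forall>c\<ge>0. \<forall>x. p (c *\<^sub>R x) = c * p x)"

text \<open>The reverse inequality for \<open>c > 0\<close> is \<open>scale\<close> applied to
  \<open>inverse c\<close> and \<open>c *\<^sub>R x\<close>. This suits infima and upper limits,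
  where only one direction is easy to estimate.\<close>

lemma sublinearI:
  assumes add: "\<And>x y. p (x + y) \<le> p x + p y"
    and zero: "p 0 = 0"
    and scale: "\<And>c x. c > 0 \<Longrightarrow> p (c *\<^sub>R x) \<le> c * p x"
  shows "sublinear p"
proof -
  have "p (c *\<^sub>R x) = c * p x" if "c \<ge> 0" for c x
  proof (cases "c = 0")
    case True
    then show ?thesis using zero by simp
  next
    case False
    then have c: "c > 0" using that by simp
    have "p x \<le> inverse c * p (c *\<^sub>R x)"
      using scale[of "inverse c" "c *\<^sub>R x"] c by simp
    then have "c * p x \<le> p (c *\<^sub>R x)" using c by (simp add: field_simps)
    with scale[OF c, of x] show ?thesis by simp
  qed
  with add show ?thesis by (simp add: sublinear_def)
qed

lemma sublinear_add: "sublinear p \<Longrightarrow> p (x + y) \<le> p x + p y"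
  by (simp add: sublinear_def)

lemma sublinear_scale: "sublinear p \<Longrightarrow> c \<ge> 0 \<Longrightarrow> p (c *\<^sub>R x) = c * p x"
  by (simp add: sublinear_def)

lemma sublinear_zero: "sublinear p \<Longrightarrow> p 0 = 0"
  using sublinear_scale[of p 0] by simp

lemma sublinear_minus: "sublinear p \<Longrightarrow> - p (- x) \<le> p x"
  using sublinear_add[of p x "- x"] sublinear_zero[of p] by simp

text \<open>Oddness turns subadditivity at \<open>- x\<close> and \<open>- y\<close> into
  superadditivity at \<open>x\<close> and \<open>y\<close>.\<close>

lemma linear_of_sublinear:
  assumes p: "sublinear p" and neg: "\<And>x. p (- x) \<le> - p x"
  shows "linear p"
proof (rule linearI)
  have minus: "p (- x) = - p x" for x
    using neg[of x] sublinear_minus[OF p, of x] by linarith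
  fix x y c
  have "- p (x + y) \<le> - p x - p y"
    using sublinear_add[OF p, of "- x" "- y"] by (simp add: minus flip: minus[of "x + y"])
  then show "p (x + y) = p x + p y"
    using sublinear_add[OF p, of x y] by linarith
  show "p (c *\<^sub>R x) = c *\<^sub>R p x"
  proof (cases "c \<ge> 0")
    case True
    then show ?thesis by (simp add: sublinear_scale[OF p])
  next
    case False
    then have "p (- (c *\<^sub>R x)) = - c * p x"
      using sublinear_scale[OF p, of "- c" x] by simp
    then show ?thesis by (simp add: minus)
  qed
qed

text \<open>
  The functional \<open>q x = (INF t\<ge>0. p (x + t h) - t p h)\<close> shows that minimal sublinear functionals are linear; it
  also forces the functional found by Zorn's lemma to agree with \<open>p\<close> at \<open>h\<close>.
\<close>

lemma sublinear_reduction: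
  fixes p :: "'a::real_vector \<Rightarrow> real"
  assumes p: "sublinear p"
  obtains q where "sublinear q" "\<And>x. q x \<le> p x" "q (- h) \<le> - p h"
proof -
  define g where "g x t = p (x + t *\<^sub>R h) - t * p h" for x t
  define q where "q x = (INF t\<in>{0..}. g x t)" for x
  \<comment> \<open>The bound is independent of \<open>t\<close>, so the infimum defining
    \<open>q\<close> is finite. It comes from writing \<open>t *\<^sub>R h\<close> as the sum of
    \<open>x + t *\<^sub>R h\<close> and \<open>- x\<close>.\<close>
  have lower: "- p (- x) \<le> g x t" if "t \<ge> 0" for x t
    using sublinear_add[OF p, of "x + t *\<^sub>R h" "- x"] sublinear_scale[OF p that, of h]
    by (simp add: g_def)
  have le: "q x \<le> g x t" if "t \<ge> 0" for x t
    unfolding q_def using lower that by (intro cINF_lower bdd_belowI2[where m = "- p (- x)"]) auto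
  have ge: "c \<le> q x" if "\<And>t. t \<ge> 0 \<Longrightarrow> c \<le> g x t" for c x
    unfolding q_def using that by (intro cINF_greatest) auto
  show ?thesis
  proof
    show "sublinear q"
    proof (rule sublinearI)
      fix x y
      have "q (x + y) - g y s \<le> q x" if s: "s \<ge> 0" for s
      proof (rule ge)
        fix t :: real assume t: "t \<ge> 0"
        have "q (x + y) \<le> g (x + y) (t + s)" using s t by (intro le) auto
        also have "\<dots> \<le> g x t + g y s"
          using sublinear_add[OF p, of "x + t *\<^sub>R h" "y + s *\<^sub>R h"]
          by (simp add: g_def algebra_simps)
        finally show "q (x + y) - g y s \<le> g x t" by simp
      qed
      then have "q (x + y) - q x \<le> q y" by (intro ge) (simp add: algebra_simps)
      then show "q (x + y) \<le> q x + q y" by simp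
    next
      have "g 0 t = 0" if "t \<ge> 0" for t
        using that by (simp add: g_def sublinear_scale[OF p])
      then show "q 0 = 0" by (intro antisym ge order_trans[OF le[of 0]]) auto
    next
      fix c :: real and x assume c: "c > 0"
      have "inverse c * q (c *\<^sub>R x) \<le> q x"
      proof (rule ge)
        fix t :: real assume t: "t \<ge> 0"
        have "q (c *\<^sub>R x) \<le> g (c *\<^sub>R x) (c * t)" using c t by (intro le) simp
        also have "\<dots> = c * g x t"
          using c sublinear_scale[OF p, of c "x + t *\<^sub>R h"] by (simp add: g_def algebra_simps)
        finally show "inverse c * q (c *\<^sub>R x) \<le> g x t" using c by (simp add: field_simps)
      qed
      then show "q (c *\<^sub>R x) \<le> c * q x" using c by (simp add: field_simps)
    qed
    show "q x \<le> p x" for x using le[of 0 x] by (simp add: g_def)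
    \<comment> \<open>At \<open>t = 1\<close> the argument \<open>- h + t *\<^sub>R h\<close>
      vanishes.\<close>
    show "q (- h) \<le> - p h" using le[of 1 "- h"] by (simp add: g_def sublinear_zero[OF p])
  qed
qed

text \<open>This supplies the lower bounds of chains for Zorn's lemma. The pointwise infimum is
  finite because every member stays above \<open>- p (- x)\<close>. Infima of sublinear functionals
  are not subadditive in general; in a chain, the smaller of two members serves for both
  summands.\<close>

lemma sublinear_chain_Inf:
  fixes C :: "('a::real_vector \<Rightarrow> real) set"
  assumes "C \<noteq> {}" and sub: "\<And>q. q \<in> C \<Longrightarrow> sublinear q"
    and chain: "\<And>q r. q \<in> C \<Longrightarrow> r \<in> C \<Longrightarrow> q \<le> r \<or> r \<le> q"
    and bound: "\<And>q. q \<in> C \<Longrightarrow> q \<le> p"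
  obtains u where "sublinear u" "\<And>q. q \<in> C \<Longrightarrow> u \<le> q"
proof -
  define u where "u x = (INF q\<in>C. q x)" for x
  have lower: "- p (- x) \<le> q x" if "q \<in> C" for q x
    using sublinear_minus[OF sub[OF that], of x] bound[OF that] by (auto simp: le_fun_def dest: spec[of _ "- x"])
  have le: "u x \<le> q x" if "q \<in> C" for q x
    unfolding u_def using lower that by (intro cINF_lower bdd_belowI2[where m = "- p (- x)"]) auto
  have ge: "c \<le> u x" if "\<And>q. q \<in> C \<Longrightarrow> c \<le> q x" for c x
    unfolding u_def using that assms(1) by (intro cINF_greatest) auto
  show ?thesis
  proof
    show "sublinear u"
    proof (rule sublinearI)
      fix x y
      have "u (x + y) - r y \<le> u x" if r: "r \<in> C" for r
      proof (rule ge)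
        fix q assume q: "q \<in> C"
        then obtain m where m: "m \<in> C" "m \<le> q" "m \<le> r" using chain[OF q r] r by auto
        have "u (x + y) \<le> m x + m y"
          using le[OF m(1)] sublinear_add[OF sub[OF m(1)]] order_trans by blast
        also have "\<dots> \<le> q x + r y" using m by (intro add_mono) (auto simp: le_fun_def)
        finally show "u (x + y) - r y \<le> q x" by simp
      qed
      then have "u (x + y) - u x \<le> u y" by (intro ge) (simp add: algebra_simps)
      then show "u (x + y) \<le> u x + u y" by simp
    next
      obtain q where "q \<in> C" using assms(1) by blast
      then show "u 0 = 0"
        using le[of q 0] ge[of 0 0] sub sublinear_zero by (metis antisym order_refl)
    next
      fix c :: real and x assume c: "c > 0"
      have "inverse c * u (c *\<^sub>R x) \<le> u x"
        using c le[of _ "c *\<^sub>R x"] sublinear_scale[OF sub, of _ c x]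
        by (intro ge) (simp add: field_simps)
      then show "u (c *\<^sub>R x) \<le> c * u x" using c by (simp add: field_simps)
    qed
    show "u \<le> q" if "q \<in> C" for q using le[OF that] by (simp add: le_fun_def)
  qed
qed

text \<open>A minimal sublinear functional below the reduction \<open>p'\<close> cannot be reduced
  further in any direction, which makes it odd and hence linear.\<close>

theorem Hahn_Banach_sublinear:
  fixes p :: "'a::real_vector \<Rightarrow> real"
  assumes p: "sublinear p"
  obtains g where "linear g" "\<And>x. g x \<le> p x" "g h = p h"
proof -
  obtain p' where p': "sublinear p'" "\<And>x. p' x \<le> p x" "p' (- h) \<le> - p h"
    using sublinear_reduction[OF p] by blast
  define S where "S = {q. sublinear q \<and> q \<le> p'}"
  have "\<exists>g\<in>S. \<forall>q\<in>S. q \<le> g \<longrightarrow> q = g"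
  proof (rule predicate_Zorn)
    \<comment> \<open>The order is reversed, so that the maximal element of Zorn's lemma is a
      minimal functional.\<close>
    show "partial_order_on S (relation_of (\<lambda>q r. r \<le> q) S)"
      by (rule partial_order_on_relation_ofI) auto
    fix C assume "C \<in> Chains (relation_of (\<lambda>q r. r \<le> q) S)"
    then have C: "C \<subseteq> S" "\<And>q r. q \<in> C \<Longrightarrow> r \<in> C \<Longrightarrow> q \<le> r \<or> r \<le> q"
      by (auto simp: Chains_def relation_of_def)
    show "\<exists>u\<in>S. \<forall>q\<in>C. u \<le> q"
    proof (cases "C = {}")
      case True
      then show ?thesis using p' by (auto simp: S_def)
    next
      case False
      then obtain u where u: "sublinear u" "\<And>q. q \<in> C \<Longrightarrow> u \<le> q"
        using sublinear_chain_Inf[of C p'] C by (auto simp: S_def)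
      then have "u \<le> p'" using False C(1) by (force simp: S_def)
      with u show ?thesis by (auto simp: S_def)
    qed
  qed
  then obtain g where g: "sublinear g" "g \<le> p'" and min: "\<And>q. sublinear q \<Longrightarrow> q \<le> p' \<Longrightarrow> q \<le> g \<Longrightarrow> q = g"
    by (auto simp: S_def)
  have "g (- x) \<le> - g x" for x
  proof -
    obtain q where q: "sublinear q" "\<And>y. q y \<le> g y" "q (- x) \<le> - g x"
      using sublinear_reduction[OF g(1)] by blast
    then have "q \<le> g" by (simp add: le_fun_def)
    with min[OF q(1)] g(2) have "q = g" by (meson order_trans)
    with q(3) show ?thesis by simp
  qed
  then have lin: "linear g" by (rule linear_of_sublinear[OF g(1)])
  have le: "g x \<le> p x" for x using g(2) p'(2)[of x] by (meson le_funD order_trans)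
  \<comment> \<open>Starting from \<open>p'\<close> instead of \<open>p\<close> pays off here: by
    linearity, the upper bound at \<open>- h\<close> is a lower bound at \<open>h\<close>.\<close>
  have "g (- h) \<le> - p h" using g(2) p'(3) by (meson le_funD order_trans)
  then have "p h \<le> g h" using lin by (simp add: linear_neg)
  with le[of h] have "g h = p h" by simp
  with lin le that show ?thesis by blast
qed

text \<open>The norm bound, used at \<open>x\<close> and at \<open>- x\<close>, makes the
  Hahn--Banach functional continuous. This is the source of subgradients that attain a directional
  derivative.\<close>

lemma bounded_sublinear_attained:
  fixes p :: "'a::real_normed_vector \<Rightarrow> real"
  assumes p: "sublinear p" and bound: "\<And>x. p x \<le> L * norm x"
  obtains a :: "'a \<Rightarrow>\<^sub>L real" where "\<And>x. blinfun_apply a x \<le> p x" "blinfun_apply a h = p h"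
proof -
  obtain g where g: "linear g" "\<And>x. g x \<le> p x" "g h = p h"
    using Hahn_Banach_sublinear[OF p] by blast
  have "\<bar>g x\<bar> \<le> norm x * L" for x
    using order_trans[OF g(2) bound, of x] order_trans[OF g(2) bound, of "- x"]
    by (simp add: linear_neg[OF g(1)] mult.commute abs_le_iff)
  then have "bounded_linear g"
    using g(1) by (intro bounded_linear_intro[where K = L]) (auto simp: linear_add linear_scale)
  with g that[of "Blinfun g"] show ?thesis by (simp add: bounded_linear_Blinfun_apply)
qed

text \<open>Subadditivity bounds \<open>p x - p y\<close> by \<open>p (x - y)\<close>.\<close>

lemma sublinear_lipschitz:
  fixes p :: "'a::real_normed_vector \<Rightarrow> real"
  assumes p: "sublinear p" and bound: "\<And>x. p x \<le> L * norm x" and "L \<ge> 0"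
  shows "L-lipschitz_on UNIV p"
proof (rule lipschitz_onI)
  fix x y
  have "p x - p y \<le> L * norm (x - y)" for x y
    using sublinear_add[OF p, of "x - y" y] bound[of "x - y"] by simp
  from this[of x y] this[of y x] show "dist (p x) (p y) \<le> L * dist x y"
    by (simp add: dist_norm norm_minus_commute abs_le_iff)
qed fact

subsection \<open>The weak* topology\<close>

lemma norm_le_of_upper_bound:
  assumes "\<And>x. blinfun_apply a x \<le> p x" "\<And>x. p x \<le> L * norm x" "L \<ge> 0"
  shows "norm a \<le> L"
proof (rule norm_blinfun_bound)
  show "norm (blinfun_apply a x) \<le> L * norm x" for x
    using order_trans[OF assms(1,2), of x] order_trans[OF assms(1,2), of "- x"]
    by (simp add: blinfun.minus_right abs_le_iff)
qed fact

text \<open>The argument of Banach and Alaoglu: as functions on the space, these functionals form a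
  closed subset of a product of compact intervals.\<close>

lemma compactin_weak_star:
  fixes p :: "'a::real_normed_vector \<Rightarrow> real"
  assumes bound: "\<And>x. p x \<le> L * norm x"
  shows "compactin weak_star_topology {a. \<forall>x. blinfun_apply a x \<le> p x}"
proof -
  define C where "C = {a. \<forall>x. blinfun_apply a x \<le> p x}"
  \<comment> \<open>Only pointwise conditions occur, so \<open>G\<close> is closed under pointwise
    limits. Continuity of its members is not demanded but recovered from the bound on
    \<open>p\<close>, so \<open>G\<close> is exactly the image of \<open>C\<close>.\<close>
  define G where "G = {g :: 'a \<Rightarrow> real. (\<forall>x y. g (x + y) = g x + g y)
    \<and> (\<forall>c x. g (c *\<^sub>R x) = c * g x) \<and> (\<forall>x. g x \<le> p x)}"
  have abs: "\<bar>g x\<bar> \<le> L * norm x" if "g \<in> G" for g x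
  proof -
    have "g (- x) = - g x" using that by (auto simp: G_def dest: spec2[of _ "-1" x])
    moreover have "g x \<le> L * norm x" "g (- x) \<le> L * norm x"
      using that bound[of x] bound[of "- x"] by (auto simp: G_def intro: order_trans)
    ultimately show ?thesis by linarith
  qed
  have img: "blinfun_apply ` C = G"
  proof (intro equalityI subsetI)
    fix g assume g: "g \<in> G"
    have "bounded_linear g"
      using g abs[OF g]
      by (intro bounded_linear_intro[where K = L]) (auto simp: G_def mult.commute)
    then show "g \<in> blinfun_apply ` C"
      using g by (intro image_eqI[of _ _ "Blinfun g"]) (auto simp: C_def G_def bounded_linear_Blinfun_apply)
  qed (auto simp: C_def G_def blinfun.add_right blinfun.scaleR_right)
  have "closed G"
    unfolding G_def
    by (intro closed_Collect_conj closed_Collect_all closed_Collect_eq closed_Collect_le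
        continuous_intros continuous_on_product_coordinates)
  moreover have "compact (PiE UNIV (\<lambda>x::'a. cball (0::real) (L * norm x)))"
    using compactin_PiE[of "\<lambda>_::'a. euclideanreal" UNIV "\<lambda>x. cball 0 (L * norm x)"]
    by (simp add: euclidean_product_topology)
  moreover have "G \<subseteq> PiE UNIV (\<lambda>x::'a. cball (0::real) (L * norm x))"
    using abs by auto
  ultimately have comp: "compact (blinfun_apply ` C)"
    using compact_Int_closed img by (metis inf.absorb_iff2)
  \<comment> \<open>The weak* topology is pulled back along \<open>blinfun_apply\<close>, so every
    open cover of \<open>C\<close> comes from one of its compact image.\<close>
  have "compactin weak_star_topology C"
    unfolding compactin_def
  proof (intro conjI allI impI)
    show "C \<subseteq> topspace weak_star_topology" by (simp add: strong_operator_topology_topspace)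
    fix \<U> assume U: "Ball \<U> (openin weak_star_topology) \<and> C \<subseteq> \<Union>\<U>"
    then have "\<forall>U\<in>\<U>. \<exists>W. open W \<and> U = blinfun_apply -` W"
      by (auto simp: strong_operator_topology_def openin_pullback_topology)
    then obtain W where W: "\<And>U. U \<in> \<U> \<Longrightarrow> open (W U)"
        "\<And>U. U \<in> \<U> \<Longrightarrow> U = blinfun_apply -` W U"
      by metis
    have "blinfun_apply ` C \<subseteq> (\<Union>U\<in>\<U>. W U)" using U W(2) by blast
    then obtain \<F> where "\<F> \<subseteq> \<U>" "finite \<F>" "blinfun_apply ` C \<subseteq> (\<Union>U\<in>\<F>. W U)"
      using compactE_image[OF comp, of \<U> W] W(1) by metis
    moreover from this have "C \<subseteq> \<Union>\<F>" using W(2) by blast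
    ultimately show "\<exists>\<F>. finite \<F> \<and> \<F> \<subseteq> \<U> \<and> C \<subseteq> \<Union>\<F>" by blast
  qed
  then show ?thesis by (simp add: C_def)
qed

text \<open>
  Minimising the squared distance over \<open>K\<close> in the coordinates \<open>I\<close> replaces the separation of a point
  from a convex set in finite dimension: an almost optimal \<open>b\<close> yields the separating vector \<open>h\<close>.
\<close>

lemma convex_finite_approximation:
  fixes K :: "('a::real_normed_vector \<Rightarrow>\<^sub>L real) set"
  assumes K: "convex K" and bounded: "\<And>b. b \<in> K \<Longrightarrow> norm b \<le> B"
    and sup: "\<And>h e. e > 0 \<Longrightarrow> \<exists>c\<in>K. blinfun_apply a h - e < blinfun_apply c h"
    and I: "finite I" and e: "e > 0"
  shows "\<exists>b\<in>K. \<forall>x\<in>I. \<bar>blinfun_apply b x - blinfun_apply a x\<bar> < e"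
proof (rule ccontr)
  assume far: "\<not> ?thesis"
  define q where "q b = (\<Sum>x\<in>I. (blinfun_apply b x - blinfun_apply a x)\<^sup>2)" for b
  define d where "d = (INF b\<in>K. q b)"
  \<comment> \<open>\<open>M\<close> bounds the squared distance, in the coordinates
    \<open>I\<close>, between any two members of \<open>K\<close>.\<close>
  define M where "M = (\<Sum>x\<in>I. (2 * B * norm x)\<^sup>2)"
  have "K \<noteq> {}" using sup[OF e] by blast
  have q_ge: "e\<^sup>2 \<le> q b" if b: "b \<in> K" for b
  proof -
    obtain x where x: "x \<in> I" "e \<le> \<bar>blinfun_apply b x - blinfun_apply a x\<bar>"
      using far b by (meson not_less)
    have "e\<^sup>2 \<le> (blinfun_apply b x - blinfun_apply a x)\<^sup>2"
      using x(2) e by (metis abs_ge_zero less_imp_le power2_abs power_mono)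
    also have "\<dots> \<le> q b" unfolding q_def using x(1) I by (intro member_le_sum) auto
    finally show ?thesis .
  qed
  have d_le: "d \<le> q b" if "b \<in> K" for b
    unfolding d_def using q_ge that by (intro cINF_lower bdd_belowI2) auto
  have "e\<^sup>2 \<le> d" unfolding d_def using q_ge \<open>K \<noteq> {}\<close> by (intro cINF_greatest)
  then have d: "d > 0" using e by (meson less_le_trans zero_less_power)
  have M: "M \<ge> 0" by (simp add: M_def sum_nonneg)
  \<comment> \<open>\<open>s\<close> is the step length from \<open>b\<close> towards a competitor
    \<open>c\<close>; \<open>s \<le> 1\<close> keeps the new point in \<open>K\<close>. The
    quadratic term \<open>s\<^sup>2 * M\<close> and the optimality gap \<open>s\<^sup>2\<close>
    together cost at most \<open>s * d\<close>, which leaves half of \<open>d\<close> for the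
    separation.\<close>
  define s where "s = min 1 (d / (1 + M))"
  have s: "0 < s" "s \<le> 1" "s \<le> d / (1 + M)" using d M by (auto simp: s_def)
  then have sM: "s * (1 + M) \<le> d" using M by (simp add: le_divide_eq)
  have "\<exists>b\<in>K. q b < d + s\<^sup>2"
  proof (rule ccontr)
    assume "\<not> ?thesis"
    then have "d + s\<^sup>2 \<le> d"
      unfolding d_def using \<open>K \<noteq> {}\<close> by (intro cINF_greatest) (auto simp: not_less d_def)
    then show False using s(1) by simp
  qed
  then obtain b where b: "b \<in> K" "q b < d + s\<^sup>2" by blast
  define u where "u x = blinfun_apply b x - blinfun_apply a x" for x
  \<comment> \<open>Pairing with \<open>h\<close> is minus the inner product with the residual
    \<open>u\<close> in the coordinates \<open>I\<close>.\<close>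
  define h where "h = - (\<Sum>x\<in>I. u x *\<^sub>R x)"
  have app_h: "blinfun_apply c h = - (\<Sum>x\<in>I. u x * blinfun_apply c x)" for c :: "'a \<Rightarrow>\<^sub>L real"
    by (simp add: h_def blinfun.minus_right blinfun.sum_right blinfun.scaleR_right)
  have "blinfun_apply c h \<le> blinfun_apply a h - d / 2" if c: "c \<in> K" for c
  proof -
    define v where "v x = blinfun_apply c x - blinfun_apply b x" for x
    have "\<bar>v x\<bar> \<le> 2 * B * norm x" for x
    proof -
      have "\<bar>v x\<bar> \<le> norm (c - b) * norm x"
        using norm_blinfun[of "c - b" x] by (simp add: v_def blinfun.diff_left)
      also have "\<dots> \<le> 2 * B * norm x"
        using norm_triangle_ineq4[of c b] bounded[OF b(1)] bounded[OF c]
        by (intro mult_right_mono) auto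
      finally show ?thesis .
    qed
    then have v_le: "(\<Sum>x\<in>I. (v x)\<^sup>2) \<le> M"
      unfolding M_def by (intro sum_mono) (metis abs_ge_zero power2_abs power_mono)
    have "d \<le> q ((1 - s) *\<^sub>R b + s *\<^sub>R c)"
      using convexD_alt[OF K b(1) c] s by (intro d_le) auto
    also have "\<dots> = (\<Sum>x\<in>I. (u x)\<^sup>2 + 2 * s * (u x * v x) + s\<^sup>2 * (v x)\<^sup>2)"
      unfolding q_def
      by (intro sum.cong refl)
        (simp add: u_def v_def blinfun.add_left blinfun.diff_left blinfun.scaleR_left power2_eq_square algebra_simps)
    also have "\<dots> = q b + 2 * s * (\<Sum>x\<in>I. u x * v x) + s\<^sup>2 * (\<Sum>x\<in>I. (v x)\<^sup>2)"
      by (simp add: q_def u_def sum.distrib flip: sum_distrib_left)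
    also have "\<dots> \<le> d + s\<^sup>2 + 2 * s * (\<Sum>x\<in>I. u x * v x) + s\<^sup>2 * M"
      using b(2) v_le s(1) by (intro add_mono mult_left_mono) auto
    finally have "0 \<le> s * (s * (1 + M) + 2 * (\<Sum>x\<in>I. u x * v x))"
      by (simp add: power2_eq_square algebra_simps)
    then have "0 \<le> s * (1 + M) + 2 * (\<Sum>x\<in>I. u x * v x)"
      using s(1) by (simp add: zero_le_mult_iff)
    then have uv: "- d / 2 \<le> (\<Sum>x\<in>I. u x * v x)" using sM by linarith
    \<comment> \<open>Here \<open>c - a\<close> splits as \<open>v + u\<close>; the first part
      contributes at least \<open>- d / 2\<close> and the second \<open>q b \<ge> d\<close>.\<close>
    have "blinfun_apply a h - blinfun_apply c h = (\<Sum>x\<in>I. u x * v x + (u x)\<^sup>2)"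
      by (simp add: app_h flip: sum_subtractf)
        (simp add: u_def v_def power2_eq_square algebra_simps)
    also have "\<dots> = (\<Sum>x\<in>I. u x * v x) + q b"
      by (simp add: sum.distrib q_def u_def)
    finally show ?thesis using uv d_le[OF b(1)] by linarith
  qed
  with sup[of "d / 2" h] d show False by (force simp: not_less)
qed

text \<open>This is the separation theorem in contrapositive form. A basic weak* neighbourhood
  restricts only finitely many coordinates, so approximation on finite sets suffices.\<close>

lemma in_weak_star_closure_of_convex:
  fixes K :: "('a::real_normed_vector \<Rightarrow>\<^sub>L real) set"
  assumes "convex K" and "\<And>b. b \<in> K \<Longrightarrow> norm b \<le> B"
    and "\<And>h e. e > 0 \<Longrightarrow> \<exists>c\<in>K. blinfun_apply a h - e < blinfun_apply c h"
  shows "a \<in> weak_star_topology closure_of K"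
  unfolding in_closure_of
proof (intro conjI allI impI)
  show "a \<in> topspace weak_star_topology" by (simp add: strong_operator_topology_topspace)
  fix T :: "('a \<Rightarrow>\<^sub>L real) set" assume T: "a \<in> T \<and> openin weak_star_topology T"
  then obtain W where W: "open W" "T = blinfun_apply -` W"
    by (auto simp: strong_operator_topology_def openin_pullback_topology)
  then obtain X where X: "blinfun_apply a \<in> PiE UNIV X" "\<And>x. open (X x)"
      "finite {x. X x \<noteq> UNIV}" "PiE UNIV X \<subseteq> W"
    using product_topology_open_contains_basis[of "\<lambda>_::'a. euclideanreal" UNIV W "blinfun_apply a"] T
    by (auto simp: euclidean_product_topology)
  define I where "I = {x. X x \<noteq> UNIV}"
  have "\<forall>x. \<exists>r>0. ball (blinfun_apply a x) r \<subseteq> X x"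
    using X(1,2) by (auto simp: open_contains_ball PiE_iff)
  then obtain r where r: "\<And>x. r x > 0" "\<And>x. ball (blinfun_apply a x) (r x) \<subseteq> X x"
    by metis
  \<comment> \<open>The inserted \<open>1\<close> keeps the minimum meaningful when \<open>I\<close>
    is empty.\<close>
  define e where "e = Min (insert 1 (r ` I))"
  have I: "finite I" using X(3) by (simp add: I_def)
  then have "e > 0" using r(1) by (simp add: e_def)
  then obtain b where b: "b \<in> K" "\<forall>x\<in>I. \<bar>blinfun_apply b x - blinfun_apply a x\<bar> < e"
    using convex_finite_approximation[OF assms I] by metis
  have "blinfun_apply b x \<in> X x" for x
  proof (cases "x \<in> I")
    case True
    then have "e \<le> r x" using I by (simp add: e_def)
    then have "blinfun_apply b x \<in> ball (blinfun_apply a x) (r x)"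
      using b(2) True by (force simp: dist_real_def abs_minus_commute)
    then show ?thesis using r(2) by blast
  qed (simp add: I_def)
  then have "b \<in> T" using X(4) W(2) by auto
  with b(1) show "\<exists>y. y \<in> K \<and> y \<in> T" by blast
qed

lemma closedin_weak_star_upper_bound:
  "closedin weak_star_topology {a. \<forall>x. blinfun_apply a x \<le> p x}"
proof -
  have "closedin weak_star_topology {a. blinfun_apply a x \<le> p x}" for x
    using closedin_continuous_map_preimage[OF strong_operator_topology_continuous_evaluation,
        of "{..p x}" x]
    by (simp add: strong_operator_topology_topspace)
  then have "closedin weak_star_topology (\<Inter>x. {a. blinfun_apply a x \<le> p x})" by blast
  moreover have "(\<Inter>x. {a. blinfun_apply a x \<le> p x}) = {a. \<forall>x. blinfun_apply a x \<le> p x}" by blast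
  ultimately show ?thesis by simp
qed

subsection \<open>Clarke derivatives\<close>

text \<open>The upper limit also runs over the base point, so the base point may move along with
  \<open>t\<close>. Subadditivity of the Clarke derivative rests on this.\<close>

lemma filterlim_clarke_shift:
  fixes x h :: "'a::real_normed_vector"
  shows "filterlim (\<lambda>(y, t). (y + t *\<^sub>R h, t)) (nhds x \<times>\<^sub>F at_right 0) (nhds x \<times>\<^sub>F at_right (0::real))"
proof -
  have "(snd \<longlongrightarrow> 0) (nhds x \<times>\<^sub>F at_right (0::real))"
    by (rule filterlim_mono[OF filterlim_snd at_within_le_nhds order_refl])
  then have "((\<lambda>z. fst z + snd z *\<^sub>R h) \<longlongrightarrow> x + 0 *\<^sub>R h) (nhds x \<times>\<^sub>F at_right (0::real))"
    by (intro tendsto_intros filterlim_fst)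
  then show ?thesis
    unfolding case_prod_beta' by (intro filterlim_Pair filterlim_snd) simp
qed

lemma eventually_clarke_shift:
  fixes x h :: "'a::real_normed_vector"
  assumes "\<forall>\<^sub>F (y, t) in nhds x \<times>\<^sub>F at_right 0. P y t"
  shows "\<forall>\<^sub>F (y, t) in nhds x \<times>\<^sub>F at_right 0. P (y + t *\<^sub>R h) t"
  using eventually_compose_filterlim[OF assms filterlim_clarke_shift[of h x]]
  by (simp add: case_prod_beta')

text \<open>This trades the extended-real upper limit for eventual inequalities between reals, in
  which all later estimates are carried out.\<close>

lemma clarke_dd_le_iff:
  "clarke_dd f x h \<le> ereal r \<longleftrightarrow>
    (\<forall>e>r. \<forall>\<^sub>F (y, t) in nhds x \<times>\<^sub>F at_right 0. (f (y + t *\<^sub>R h) - f y) / t < e)"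
  (is "?L \<longleftrightarrow> ?R")
proof
  assume ?L
  then have "\<forall>e>ereal r. \<forall>\<^sub>F z in nhds x \<times>\<^sub>F at_right 0.
      (case z of (y, t) \<Rightarrow> ereal ((f (y + t *\<^sub>R h) - f y) / t)) < e"
    unfolding clarke_dd_def Limsup_le_iff .
  then show ?R
    by (metis (mono_tags, lifting) case_prod_beta' eventually_mono less_ereal.simps(1))
next
  assume R: ?R
  show ?L
    unfolding clarke_dd_def Limsup_le_iff
  proof (intro allI impI)
    fix e assume e: "ereal r < e"
    \<comment> \<open>\<open>e\<close> may be infinite, so a real number is inserted below
      it.\<close>
    then obtain e' where e': "r < e'" "ereal e' < e" using ereal_dense2 by force
    from R e'(1) have "\<forall>\<^sub>F (y, t) in nhds x \<times>\<^sub>F at_right 0. (f (y + t *\<^sub>R h) - f y) / t < e'" by blast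
    then show "\<forall>\<^sub>F z in nhds x \<times>\<^sub>F at_right 0.
        (case z of (y, t) \<Rightarrow> ereal ((f (y + t *\<^sub>R h) - f y) / t)) < e"
      by eventually_elim (use e'(2) in \<open>auto intro: less_trans[of "ereal _" "ereal e'" e]\<close>)
  qed
qed

lemma eventually_snd_pos:
  "\<forall>\<^sub>F (y, t) in F \<times>\<^sub>F at_right (0::real). 0 < t"
  using eventually_compose_filterlim[OF eventually_at_right_less filterlim_snd]
  by (simp add: case_prod_beta')

text \<open>The difference quotient splits at the intermediate point
  \<open>y + t *\<^sub>R h\<close>, a base point that still tends to \<open>x\<close>.\<close>

lemma clarke_dd_add_le:
  assumes "clarke_dd f x h \<le> ereal r" "clarke_dd f x k \<le> ereal s"
  shows "clarke_dd f x (h + k) \<le> ereal (r + s)"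
  unfolding clarke_dd_le_iff
proof (intro allI impI)
  fix e assume "r + s < e"
  then obtain d where d: "d > 0" "r + d + (s + d) = e"
    by (intro that[of "(e - r - s) / 2"]) auto
  let ?F = "nhds x \<times>\<^sub>F at_right (0::real)"
  have "\<forall>\<^sub>F (y, t) in ?F. (f (y + t *\<^sub>R h) - f y) / t < r + d"
    using assms(1) d(1) by (simp add: clarke_dd_le_iff)
  moreover have "\<forall>\<^sub>F (y, t) in ?F. (f (y + t *\<^sub>R k) - f y) / t < s + d"
    using assms(2) d(1) by (simp add: clarke_dd_le_iff)
  then have "\<forall>\<^sub>F (y, t) in ?F. (f ((y + t *\<^sub>R h) + t *\<^sub>R k) - f (y + t *\<^sub>R h)) / t < s + d"
    by (rule eventually_clarke_shift)
  ultimately show "\<forall>\<^sub>F (y, t) in ?F. (f (y + t *\<^sub>R (h + k)) - f y) / t < e"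
  proof eventually_elim
    case (elim z)
    obtain y t where z: "z = (y, t)" by force
    have "(f (y + t *\<^sub>R (h + k)) - f y) / t =
        (f (y + t *\<^sub>R h + t *\<^sub>R k) - f (y + t *\<^sub>R h)) / t + (f (y + t *\<^sub>R h) - f y) / t"
      by (simp add: algebra_simps flip: add_divide_distrib)
    then show ?case using elim d(2) by (simp add: z)
  qed
qed

text \<open>The quotient in direction \<open>c *\<^sub>R h\<close> at \<open>t\<close> is
  \<open>c\<close> times the quotient in direction \<open>h\<close> at \<open>c * t\<close>.\<close>

lemma clarke_dd_scale_le:
  assumes "clarke_dd f x h \<le> ereal r" and c: "c > 0"
  shows "clarke_dd f x (c *\<^sub>R h) \<le> ereal (c * r)"
  unfolding clarke_dd_le_iff
proof (intro allI impI)
  fix e assume "c * r < e"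
  then have "r < e / c" using c by (simp add: field_simps)
  let ?F = "nhds x \<times>\<^sub>F at_right (0::real)"
  have ev: "\<forall>\<^sub>F (y, t) in ?F. (f (y + t *\<^sub>R h) - f y) / t < e / c"
    using assms(1) \<open>r < e / c\<close> by (simp add: clarke_dd_le_iff)
  have "filterlim (\<lambda>t. c * t) (at_right 0) (at_right (0::real))"
    using c by (auto simp: filterlim_at eventually_at_right_less intro!: tendsto_eq_intros
        eventually_mono[OF eventually_at_right_less])
  then have "filterlim (\<lambda>(y, t). (y, c * t)) ?F ?F"
    unfolding case_prod_beta'
    by (intro filterlim_Pair filterlim_fst filterlim_compose[OF _ filterlim_snd])
  from eventually_compose_filterlim[OF ev this]
  have "\<forall>\<^sub>F (y, t) in ?F. (f (y + (c * t) *\<^sub>R h) - f y) / (c * t) < e / c"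
    by (simp add: case_prod_beta')
  then show "\<forall>\<^sub>F (y, t) in ?F. (f (y + t *\<^sub>R (c *\<^sub>R h)) - f y) / t < e"
    by eventually_elim
      (use c in \<open>auto simp: divide_less_cancel mult.commute[of c] simp flip: divide_divide_eq_left\<close>)
qed

text \<open>Openness of \<open>V\<close> keeps both \<open>y\<close> and
  \<open>y + t *\<^sub>R h\<close> eventually inside the set where the Lipschitz estimate
  holds.\<close>

lemma clarke_dd_abs_le:
  assumes lip: "L-lipschitz_on U f" and "open V" "x \<in> V" "V \<subseteq> U"
  shows "- ereal (L * norm h) \<le> clarke_dd f x h" "clarke_dd f x h \<le> ereal (L * norm h)"
proof -
  let ?F = "nhds x \<times>\<^sub>F at_right (0::real)"
  have inV: "\<forall>\<^sub>F y in nhds x. y \<in> V" using assms by (simp add: eventually_nhds_in_open)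
  have fst: "\<forall>\<^sub>F (y, t) in ?F. y \<in> V"
    using eventually_compose_filterlim[OF inV filterlim_fst] by (simp add: case_prod_beta')
  then have shift: "\<forall>\<^sub>F (y, t) in ?F. y + t *\<^sub>R h \<in> V"
    by (rule eventually_clarke_shift)
  have ev: "\<forall>\<^sub>F (y, t) in ?F. \<bar>(f (y + t *\<^sub>R h) - f y) / t\<bar> \<le> L * norm h"
    using fst shift eventually_snd_pos
  proof eventually_elim
    case (elim z)
    obtain y t where z: "z = (y, t)" by force
    have "\<bar>f (y + t *\<^sub>R h) - f y\<bar> \<le> L * (t * norm h)"
      using elim lipschitz_onD[OF lip, of "y + t *\<^sub>R h" y] \<open>V \<subseteq> U\<close>
      by (auto simp: z dist_norm)
    then show ?case using elim by (simp add: z field_simps abs_divide)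
  qed
  have ne: "?F \<noteq> bot" by (simp add: prod_filter_eq_bot)
  show "- ereal (L * norm h) \<le> clarke_dd f x h"
    unfolding clarke_dd_def by (rule le_Limsup[OF ne])
      (use ev in eventually_elim, auto simp: abs_le_iff simp del: abs_divide)
  show "clarke_dd f x h \<le> ereal (L * norm h)"
    unfolding clarke_dd_def by (rule Limsup_bounded)
      (use ev in eventually_elim, auto simp: abs_le_iff simp del: abs_divide)
qed

section \<open>Descent along segments\<close>

lemma clarke_dd_le_imp_decrease:
  assumes "clarke_dd f x h \<le> ereal r" "r < e"
  obtains d where "d > 0"
    "\<And>y t. dist y x < d \<Longrightarrow> 0 \<le> t \<Longrightarrow> t < d \<Longrightarrow> f (y + t *\<^sub>R h) \<le> f y + t * e"
proof -
  have "\<forall>\<^sub>F (y, t) in nhds x \<times>\<^sub>F at_right 0. (f (y + t *\<^sub>R h) - f y) / t < e"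
    using assms by (simp add: clarke_dd_le_iff)
  then obtain P Q where P: "eventually P (nhds x)" and Q: "eventually Q (at_right (0::real))"
      and PQ: "\<And>y t. P y \<Longrightarrow> Q t \<Longrightarrow> (f (y + t *\<^sub>R h) - f y) / t < e"
    by (auto simp: eventually_prod_filter)
  obtain d1 where d1: "d1 > 0" "\<And>y. dist y x < d1 \<Longrightarrow> P y"
    using P by (auto simp: eventually_nhds_metric)
  obtain d2 where d2: "d2 > 0" "\<And>t. 0 < t \<Longrightarrow> t < d2 \<Longrightarrow> Q t"
    using Q by (auto simp: eventually_at_right_field)
  show ?thesis
  proof
    show "min d1 d2 > 0" using d1 d2 by simp
    fix y t assume "dist y x < min d1 d2" "0 \<le> t" "t < min d1 d2"
    then show "f (y + t *\<^sub>R h) \<le> f y + t * e"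
      using PQ[OF d1(2) d2(2), of y t] by (cases "t = 0") (auto simp: field_simps)
  qed
qed

text \<open>Strict local bounds with slope \<open>e > r\<close> are chained on compact parts of the
  open segment; then \<open>e\<close> tends to \<open>r\<close>, and continuity of \<open>f\<close>
  reaches the endpoints, where no bound on the derivative is assumed.\<close>

lemma clarke_mean_value_le:
  fixes f :: "'a::real_normed_vector \<Rightarrow> real"
  assumes cont: "continuous_on UNIV f" and t: "t > 0" and h: "h \<noteq> 0"
    and le: "\<And>y. y \<in> open_segment x (x + t *\<^sub>R h) \<Longrightarrow> clarke_dd f y h \<le> ereal r"
  shows "f (x + t *\<^sub>R h) \<le> f x + t * r"
proof -
  define g where "g s = f (x + s *\<^sub>R h)" for s
  have seg: "x + s *\<^sub>R h \<in> open_segment x (x + t *\<^sub>R h)" if "0 < s" "s < t" for s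
    unfolding in_segment using that t h
    by (auto intro!: exI[of _ "s / t"] simp: algebra_simps)
  have inner: "g v - g u \<le> (v - u) * e" if "0 < u" "u \<le> v" "v < t" "r < e" for u v e
    using \<open>u \<le> v\<close>
  \<comment> \<open>The estimate is additive over adjacent intervals, so it suffices to have it on
    all short intervals around each point.\<close>
  proof (induction rule: Bolzano)
    case (trans a b c)
    then show ?case by (simp add: algebra_simps)
  next
    case (local s)
    then have "clarke_dd f (x + s *\<^sub>R h) h \<le> ereal r" using that by (intro le seg) auto
    then obtain d where d: "d > 0" "\<And>y \<tau>. dist y (x + s *\<^sub>R h) < d \<Longrightarrow> 0 \<le> \<tau> \<Longrightarrow> \<tau> < d
        \<Longrightarrow> f (y + \<tau> *\<^sub>R h) \<le> f y + \<tau> * e"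
      using clarke_dd_le_imp_decrease \<open>r < e\<close> by metis
    show ?case
    \<comment> \<open>The bound \<open>d\<close> limits the step \<open>b - a\<close>; the bound
      \<open>d / norm h\<close> keeps the left end \<open>x + a *\<^sub>R h\<close> within distance
      \<open>d\<close> of \<open>x + s *\<^sub>R h\<close>.\<close>
    proof (intro exI[of _ "min d (d / norm h)"] conjI allI impI)
      show "0 < min d (d / norm h)" using d h by simp
      fix a b assume ab: "a \<le> s \<and> s \<le> b \<and> b - a < min d (d / norm h)"
      have "dist (x + a *\<^sub>R h) (x + s *\<^sub>R h) = (s - a) * norm h"
        using ab by (simp add: dist_norm flip: scaleR_diff_left)
      also have "\<dots> \<le> (b - a) * norm h" using ab by (intro mult_right_mono) auto
      also have "\<dots> < d" using ab h by (simp add: field_simps)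
      finally show "g b - g a \<le> (b - a) * e"
        using d(2)[of "x + a *\<^sub>R h" "b - a"] ab by (simp add: g_def algebra_simps)
    qed
  qed
  have inner_r: "g v - g u \<le> (v - u) * r" if "0 < u" "u \<le> v" "v < t" for u v
  proof (rule tendsto_lowerbound)
    show "((\<lambda>e. (v - u) * e) \<longlongrightarrow> (v - u) * r) (at_right r)" by (intro tendsto_intros)
    show "\<forall>\<^sub>F e in at_right r. g v - g u \<le> (v - u) * e"
      using inner that by (auto intro: eventually_mono[OF eventually_at_right_less])
  qed simp
  have cont_g: "continuous_on UNIV g"
    unfolding g_def by (intro continuous_on_compose2[OF cont] continuous_intros) auto
  have "((\<lambda>s. (g (t - s) - g s)) \<longlongrightarrow> g (t - 0) - g 0) (at_right 0)"
    using cont_g by (intro tendsto_intros isCont_tendsto_compose[of _ g])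
      (auto simp: continuous_on_eq_continuous_at intro!: tendsto_intros)
  moreover have "((\<lambda>s. ((t - s) - s) * r) \<longlongrightarrow> ((t - 0) - 0) * r) (at_right 0)"
    by (intro tendsto_intros)
  \<comment> \<open>For \<open>s < t / 2\<close> the points \<open>s\<close> and
    \<open>t - s\<close> are in order and lie strictly between \<open>0\<close> and
    \<open>t\<close>.\<close>
  moreover have "\<forall>\<^sub>F s in at_right 0. g (t - s) - g s \<le> ((t - s) - s) * r"
    unfolding eventually_at_right_field using t
    by (intro exI[of _ "t / 2"] conjI allI impI inner_r) auto
  ultimately have "g (t - 0) - g 0 \<le> ((t - 0) - 0) * r"
    by (intro tendsto_le[of "at_right 0"]) auto
  then show ?thesis by (simp add: g_def)
qed

text \<open>The hypotheses speak of real upper bounds, which pass directly to suprema. The lemma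
  thus serves the derivative at a point and the derivative on a set alike.\<close>

lemma ereal_sublinear_real:
  fixes D :: "'a::real_normed_vector \<Rightarrow> ereal"
  assumes lower: "\<And>h. - ereal (L * norm h) \<le> D h"
    and upper: "\<And>h. D h \<le> ereal (L * norm h)"
    and add: "\<And>h k r s. D h \<le> ereal r \<Longrightarrow> D k \<le> ereal s \<Longrightarrow> D (h + k) \<le> ereal (r + s)"
    and scale: "\<And>c h r. c > 0 \<Longrightarrow> D h \<le> ereal r \<Longrightarrow> D (c *\<^sub>R h) \<le> ereal (c * r)"
  obtains p where "sublinear p" "\<And>h. D h = ereal (p h)" "\<And>h. p h \<le> L * norm h"
proof
  define p where "p h = real_of_ereal (D h)" for h
  have D: "D h = ereal (p h)" for h
    using lower[of h] upper[of h] by (cases "D h") (auto simp: p_def)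
  then show "D h = ereal (p h)" for h .
  show "p h \<le> L * norm h" for h using upper[of h] by (simp add: D)
  show "sublinear p"
  proof (rule sublinearI)
    show "p (x + y) \<le> p x + p y" for x y using add[of x "p x" y "p y"] by (simp add: D)
    show "p 0 = 0" using lower[of 0] upper[of 0] by (simp add: D)
    show "p (c *\<^sub>R x) \<le> c * p x" if "c > 0" for c x
      using scale[OF that, of x "p x"] by (simp add: D)
  qed
qed

lemma clarke_dd_sublinear:
  assumes "L-lipschitz_on U f" "open V" "x \<in> V" "V \<subseteq> U"
  obtains p where "sublinear p" "\<And>h. clarke_dd f x h = ereal (p h)" "\<And>h. p h \<le> L * norm h"
  using ereal_sublinear_real[of L "clarke_dd f x"] clarke_dd_abs_le[OF assms]
    clarke_dd_add_le clarke_dd_scale_le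
  by metis

section \<open>Derivative and gradient on a set\<close>

lemma clarke_dd_on_le_iff: "clarke_dd_on f A h \<le> r \<longleftrightarrow> (\<forall>y\<in>A. clarke_dd f y h \<le> r)"
  by (simp add: clarke_dd_on_def SUP_le_iff)

lemma clarke_dd_on_sublinear:
  assumes "A \<noteq> {}" and lip: "L-lipschitz_on U f" and V: "open V" "A \<subseteq> V" "V \<subseteq> U"
  obtains p where "sublinear p" "\<And>h. clarke_dd_on f A h = ereal (p h)" "\<And>h. p h \<le> L * norm h"
proof (rule ereal_sublinear_real[of L "clarke_dd_on f A"])
  have bounds: "- ereal (L * norm h) \<le> clarke_dd f y h" "clarke_dd f y h \<le> ereal (L * norm h)"
    if "y \<in> A" for y h
    using clarke_dd_abs_le[OF lip V(1) _ V(3)] that V(2) by blast+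
  show "- ereal (L * norm h) \<le> clarke_dd_on f A h" for h
    using bounds(1) assms(1) unfolding clarke_dd_on_def by (meson SUP_upper2 ex_in_conv)
  show "clarke_dd_on f A h \<le> ereal (L * norm h)" for h
    using bounds(2) by (simp add: clarke_dd_on_le_iff)
qed (auto simp: clarke_dd_on_le_iff simp del: plus_ereal.simps times_ereal.simps
    intro: clarke_dd_add_le clarke_dd_scale_le that)

text \<open>The right-hand side is convex, weak* closed and contains every gradient, which gives one
  inclusion. For the other, no member of it exceeds the support function of the union of the
  gradients, so none can be separated from the closed convex hull.\<close>

lemma clarke_gradient_on_eq:
  assumes "A \<noteq> {}" and lip: "L-lipschitz_on U f" and V: "open V" "A \<subseteq> V" "V \<subseteq> U"
  shows "clarke_gradient_on f A = {a. \<forall>h. ereal (blinfun_apply a h) \<le> clarke_dd_on f A h}"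
    (is "_ = ?C")
proof -
  obtain p where p: "sublinear p" "\<And>h. clarke_dd_on f A h = ereal (p h)" "\<And>h. p h \<le> L * norm h"
    using clarke_dd_on_sublinear[OF assms] by blast
  have C: "?C = {a. \<forall>h. blinfun_apply a h \<le> p h}" by (simp add: p(2))
  define K where "K = convex hull (\<Union>y\<in>A. clarke_gradient f y)"
  have grad: "(\<Union>y\<in>A. clarke_gradient f y) \<subseteq> ?C"
    unfolding clarke_gradient_def clarke_dd_on_def by (auto intro: SUP_upper2)
  moreover have "convex ?C"
    unfolding C convex_def
    by (auto simp: blinfun.add_left blinfun.scaleR_left intro: convex_bound_le)
  ultimately have K: "K \<subseteq> ?C" unfolding K_def by (rule hull_minimal)
  have "weak_star_topology closure_of K \<subseteq> ?C"
    using K closedin_weak_star_upper_bound[of p] unfolding C by (intro closure_of_minimal)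
  moreover have "a \<in> weak_star_topology closure_of K" if a: "a \<in> ?C" for a
  proof (rule in_weak_star_closure_of_convex)
    show "convex K" by (simp add: K_def convex_convex_hull)
    show "norm b \<le> L" if "b \<in> K" for b
      using K that p(3) lipschitz_on_nonneg[OF lip] by (intro norm_le_of_upper_bound[of _ p]) (auto simp: C)
    fix h and e :: real assume "e > 0"
    then have "ereal (blinfun_apply a h - e) < clarke_dd_on f A h"
      using a by (auto simp: p(2) C intro: less_le_trans[of _ "blinfun_apply a h"])
    \<comment> \<open>The supremum over \<open>A\<close> need not be attained; it is approached at
      some \<open>y\<close>, and a subgradient at that \<open>y\<close> then attains the derivative
      exactly.\<close>
    then obtain y where y: "y \<in> A" "ereal (blinfun_apply a h - e) < clarke_dd f y h"
      by (auto simp: clarke_dd_on_def less_SUP_iff)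
    obtain q where q: "sublinear q" "\<And>h. clarke_dd f y h = ereal (q h)" "\<And>h. q h \<le> L * norm h"
      using clarke_dd_sublinear[OF lip V(1) _ V(3)] y(1) V(2) by blast
    obtain c where c: "\<And>x. blinfun_apply c x \<le> q x" "blinfun_apply c h = q h"
      using bounded_sublinear_attained[OF q(1,3)] by blast
    have "c \<in> K"
      unfolding K_def using c(1) by (intro hull_inc UN_I[OF y(1)]) (simp add: clarke_gradient_def q(2))
    then show "\<exists>c\<in>K. blinfun_apply a h - e < blinfun_apply c h"
      using y(2) c(2) by (intro bexI[of _ c]) (simp_all add: q(2))
  qed
  ultimately show ?thesis by (auto simp: clarke_gradient_on_def K_def)
qed

lemma locally_lipschitz_continuous_on:
  assumes "locally_lipschitz f"
  shows "continuous_on UNIV f"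
proof (rule continuous_at_imp_continuous_on, rule ballI)
  fix x
  obtain U K where "open U" "x \<in> U" "K-lipschitz_on U f"
    using assms unfolding locally_lipschitz_def by metis
  then show "isCont f x"
    using continuous_on_eq_continuous_at lipschitz_on_continuous_on by blast
qed

theorem proposition2p3:
  fixes f :: "'a::banach \<Rightarrow> real" and A U V :: "'a set" and L :: real
  assumes "A \<noteq> {}"
    and "locally_lipschitz f"
    and "open V" and "A \<subseteq> V" and "V \<subseteq> U"
    and "L-lipschitz_on U f"
  shows
    "(clarke_gradient_on f A \<noteq> {}
      \<and> convex (clarke_gradient_on f A)
      \<and> compactin weak_star_topology (clarke_gradient_on f A)
      \<and> (\<forall>a\<in>clarke_gradient_on f A. norm a \<le> L))
    \<and> ((\<forall>h. \<bar>clarke_dd_on f A h\<bar> \<noteq> \<infinity>)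
      \<and> (\<forall>c h. c \<ge> 0 \<longrightarrow> clarke_dd_on f A (c *\<^sub>R h) = ereal c * clarke_dd_on f A h)
      \<and> (\<forall>h k. clarke_dd_on f A (h + k) \<le> clarke_dd_on f A h + clarke_dd_on f A k)
      \<and> L-lipschitz_on UNIV (\<lambda>h. real_of_ereal (clarke_dd_on f A h))
      \<and> (\<forall>h. clarke_dd_on f A h = support_function (clarke_gradient_on f A) h
            \<and> (\<exists>a\<in>clarke_gradient_on f A. ereal (blinfun_apply a h) = clarke_dd_on f A h)))
    \<and> clarke_gradient_on f A = {a. \<forall>h. ereal (blinfun_apply a h) \<le> clarke_dd_on f A h}
    \<and> (\<forall>h x t. clarke_dd_on f A h < 0 \<longrightarrow> x \<in> A \<longrightarrow> t > 0
        \<longrightarrow> open_segment x (x + t *\<^sub>R h) \<subseteq> A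
        \<longrightarrow> ereal (f (x + t *\<^sub>R h)) \<le> ereal (f x) + ereal t * clarke_dd_on f A h
          \<and> ereal (f x) + ereal t * clarke_dd_on f A h < ereal (f x))"
proof -
  have L: "L \<ge> 0" using assms(6) by (rule lipschitz_on_nonneg)
  obtain p where p: "sublinear p" "\<And>h. clarke_dd_on f A h = ereal (p h)" "\<And>h. p h \<le> L * norm h"
    using clarke_dd_on_sublinear[OF assms(1,6,3-5)] by blast
  have eq: "clarke_gradient_on f A = {a. \<forall>h. ereal (blinfun_apply a h) \<le> clarke_dd_on f A h}"
    by (rule clarke_gradient_on_eq[OF assms(1,6,3-5)])
  then have C: "clarke_gradient_on f A = {a. \<forall>h. blinfun_apply a h \<le> p h}"
    by (simp add: p(2))
  \<comment> \<open>Hahn--Banach is applied to \<open>p\<close> itself: the functional obtained lies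
    below \<open>p\<close>, hence in the gradient on \<open>A\<close>. The maximum is therefore
    attained even where the supremum over \<open>A\<close> is not.\<close>
  have attained: "\<exists>a\<in>clarke_gradient_on f A. blinfun_apply a h = p h" for h
    using bounded_sublinear_attained[OF p(1,3), of h] by (auto simp: C)
  \<comment> \<open>Stated for the explicit set, since the final rewriting with \<open>C\<close>
    replaces the gradient by it before \<open>support\<close> applies.\<close>
  have support: "support_function {a. \<forall>h. blinfun_apply a h \<le> p h} h = ereal (p h)" for h
    unfolding support_function_def C[symmetric]
  proof (rule antisym)
    show "(SUP a\<in>clarke_gradient_on f A. ereal (blinfun_apply a h)) \<le> ereal (p h)"
      by (intro SUP_least) (simp add: C)
    show "ereal (p h) \<le> (SUP a\<in>clarke_gradient_on f A. ereal (blinfun_apply a h))"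
      using attained[of h] by (auto intro: SUP_upper2)
  qed
  have "clarke_gradient_on f A \<noteq> {}" using attained[of 0] by blast
  moreover have "convex (clarke_gradient_on f A)"
    unfolding C convex_def
    by (auto simp: blinfun.add_left blinfun.scaleR_left intro: convex_bound_le)
  moreover have "compactin weak_star_topology (clarke_gradient_on f A)"
    unfolding C using p(3) by (rule compactin_weak_star)
  moreover have "norm a \<le> L" if "a \<in> clarke_gradient_on f A" for a
    using that p(3) L by (intro norm_le_of_upper_bound[of _ p]) (auto simp: C)
  moreover have "L-lipschitz_on UNIV p" using p(1,3) L by (rule sublinear_lipschitz)
  moreover have "f (x + t *\<^sub>R h) \<le> f x + t * p h"
    if "p h < 0" "t > 0" "open_segment x (x + t *\<^sub>R h) \<subseteq> A" for x h t
  proof (rule clarke_mean_value_le)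
    show "continuous_on UNIV f" using assms(2) by (rule locally_lipschitz_continuous_on)
    show "h \<noteq> 0" using that(1) sublinear_zero[OF p(1)] by auto
    fix y assume "y \<in> open_segment x (x + t *\<^sub>R h)"
    then have "clarke_dd f y h \<le> clarke_dd_on f A h"
      using that(3) by (auto simp: clarke_dd_on_def intro: SUP_upper)
    then show "clarke_dd f y h \<le> ereal (p h)" by (simp add: p(2))
  qed fact
  ultimately show ?thesis
    using attained sublinear_add[OF p(1)] sublinear_scale[OF p(1)]
    unfolding p(2) C support by (auto simp: mult_pos_neg)
qed

end
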